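(* Let $Y_i=(Y_{i,1},\dots,Y_{i,K})$, $i\ge 1$, be i.i.d. Gaussian vectors in $\mathbb{R}^K$ with $\mathbb{E}[Y_i]=\mathbf{0}$ and $\mathrm{Cov}(Y_{i,j},Y_{i,k})=\Sigma_{jk}$. Then for all $i\ge 1$: (a) The expected maximum satisfies $$\mathbb{E}[M_n]=\sqrt n\,\mathbb{E}\Bigl[\max_{1\le k\le K}Z_k\Bigr],$$ where $Z=(Z_1,\dots,Z_K)\sim N(\mathbf{0},\Sigma)$. (b) The per-step selection premium is $$\mathbb{E}[\varphi_K(S_{i-1})]=\mathbb{E}\Bigl[\max_{1\le k\le K}Z_k\Bigr]\bigl(\sqrt i-\sqrt{i-1}\bigr),\quad i\ge 1.$$ (c) The normalized selection premium is $$\psi_K(i):=\frac{\mathbb{E}[\varphi_K(S_{i-1})]}{\varphi_K(\mathbf{0})}=\sqrt i-\sqrt{i-1}\sim\frac{1}{2\sqrt i}\quad(i\to\infty),$$ which is independent of $K$ and $\Sigma$. (d) The map $n\mapsto\mathbb{E}[M_n]$ is concave: for all $n\ge 1$, $$\mathbb{E}[\varphi_K(S_n)]\le\mathbb{E}[\varphi_K(S_{n-1})].$$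
   Context: $K\ge 1$ is an integer, $S_{n,k}=\sum_{i=1}^nY_{i,k}$, $S_n=(S_{n,1},\dots,S_{n,K})$, $S_0=\mathbf{0}=(0,\dots,0)\in\mathbb{R}^K$, and $M_n=\max_{1\le k\le K}S_{n,k}$. The matrix $\Sigma=(\Sigma_{jk})$ is the $K\times K$ covariance matrix of each $Y_i$. The selection premium function $\varphi_K:\mathbb{R}^K\to\mathbb{R}$ is $$\varphi_K(u)=\mathbb{E}\Bigl[\max_{1\le k\le K}(u_k+Y_k)\Bigr]-\max_{1\le k\le K}u_k,$$ where $Y=(Y_1,\dots,Y_K)$ inside this formula denotes a random vector with the same distribution as the increment vector $(Y_{1,1},\dots,Y_{1,K})$. The notation $a_i\sim b_i$ for sequences means $a_i/b_i\to 1$.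
   Formalization: Part (c) on ψ_K is stated under the condition φ_K(0) ≠ 0, since otherwise (for example K = 1 or Σ = 0) the quotient defining ψ_K(i) is 0/0; the asymptotics of √i − √(i−1) is stated without this condition. *)

theory Defs
  imports "HOL-Probability.Probability"
begin

text \<open>The index set \<open>{1,\<dots>,K}\<close> is a finite type \<open>'k\<close>, so that \<open>K = CARD('k) \<ge> 1\<close> and
  \<open>\<real>\<^sup>K\<close> is \<open>real ^ 'k\<close>.\<close>

text \<open>Normal law with mean \<open>m\<close> and standard deviation \<open>s \<ge> 0\<close>. The value \<open>s = 0\<close> is the point
  mass at \<open>m\<close>; it is needed because covariance matrices may be singular.\<close>

definition normal_law :: "real \<Rightarrow> real \<Rightarrow> real measure" where
  "normal_law m s = (if s = 0 then return borel m else density lborel (normal_density m s))"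

definition gaussian_vector :: "'a measure \<Rightarrow> ('a \<Rightarrow> real ^ 'k) \<Rightarrow> bool" where
  "gaussian_vector M X \<longleftrightarrow>
     X \<in> borel_measurable M \<and>
     (\<forall>a. \<exists>m s. s \<ge> 0 \<and> distr M borel (\<lambda>\<omega>. a \<bullet> X \<omega>) = normal_law m s)"

definition cov :: "'a measure \<Rightarrow> ('a \<Rightarrow> real) \<Rightarrow> ('a \<Rightarrow> real) \<Rightarrow> real" where
  "cov M U V = (\<integral>\<omega>. (U \<omega> - (\<integral>\<omega>'. U \<omega>' \<partial>M)) * (V \<omega> - (\<integral>\<omega>'. V \<omega>' \<partial>M)) \<partial>M)"

definition multivariate_normal ::
  "'a measure \<Rightarrow> ('a \<Rightarrow> real ^ 'k) \<Rightarrow> real ^ 'k \<Rightarrow> real ^ 'k ^ 'k \<Rightarrow> bool" where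
  "multivariate_normal M X \<mu> \<Sigma> \<longleftrightarrow>
     gaussian_vector M X \<and>
     (\<integral>\<omega>. X \<omega> \<partial>M) = \<mu> \<and>
     (\<forall>j k. cov M (\<lambda>\<omega>. X \<omega> $ j) (\<lambda>\<omega>. X \<omega> $ k) = \<Sigma> $ j $ k)"

definition max_coord :: "real ^ 'k \<Rightarrow> real" where
  "max_coord u = (MAX k. u $ k)"

definition walk :: "(nat \<Rightarrow> 'a \<Rightarrow> real ^ 'k) \<Rightarrow> nat \<Rightarrow> 'a \<Rightarrow> real ^ 'k" where
  "walk Y n \<omega> = (\<Sum>i=1..n. Y i \<omega>)"

definition walk_max :: "(nat \<Rightarrow> 'a \<Rightarrow> real ^ 'k) \<Rightarrow> nat \<Rightarrow> 'a \<Rightarrow> real" where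
  "walk_max Y n \<omega> = max_coord (walk Y n \<omega>)"

text \<open>The premium depends on the increments only through their law \<open>D\<close>, which is therefore
  its parameter.\<close>

definition selection_premium :: "(real ^ 'k) measure \<Rightarrow> real ^ 'k \<Rightarrow> real" where
  "selection_premium D u = (\<integral>y. max_coord (u + y) \<partial>D) - max_coord u"

text \<open>Concavity of a sequence: its increments are nonincreasing.\<close>

definition concave_seq :: "(nat \<Rightarrow> real) \<Rightarrow> bool" where
  "concave_seq f \<longleftrightarrow> (\<forall>n\<ge>1. f (n + 1) - f n \<le> f n - f (n - 1))"

end

theory Submission
  imports Defs "HOL-Real_Asymp.Real_Asymp"
begin

text \<open>A law on a Euclidean space is determined by its characteristic function, hence by its
  one-dimensional projections. The projections of \<open>S\<^sub>n\<close> and of \<open>\<surd>n Z\<close> along \<open>a\<close> have the same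
  characteristic function, namely that of a centred normal law with variance \<open>n (a \<bullet> \<Sigma> a)\<close>, so
  \<open>S\<^sub>n\<close> and \<open>\<surd>n Z\<close> have the same law; as the maximum is positively homogeneous this is (a).
  Since \<open>Y\<^sub>i\<close> is independent of \<open>S\<^sub>i\<^sub>-\<^sub>1\<close>, Fubini turns the expected premium into the increment
  \<open>E[M\<^sub>i] - E[M\<^sub>i\<^sub>-\<^sub>1]\<close>, and the rest is the behaviour of the increments of the square root,
  together with \<open>E[max Z\<^sub>k] \<ge> 0\<close> for (d).\<close>

section \<open>Characteristic functions determine laws\<close>

text \<open>Dividing the weight \<open>f\<close> by its total mass \<open>c\<close> gives a
  probability density. After this change of measure, \<open>eq\<close> says that \<open>X\<close>
  has the same characteristic function on both sides, so the one-dimensional uniqueness theorem of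
  Levy applies. If \<open>c = 0\<close>, the weight vanishes almost everywhere.\<close>

lemma integral_indicator_eqI_weighted_char:
  fixes P Q :: "'b measure" and X f :: "'b \<Rightarrow> real"
  assumes P: "prob_space P" and Q: "prob_space Q" and PQ: "sets P = sets Q"
    and X [measurable]: "X \<in> borel_measurable P"
    and f [measurable]: "f \<in> borel_measurable P"
    and f0: "\<And>x. 0 \<le> f x" and fC: "\<And>x. f x \<le> C"
    and eq: "\<And>s. (CLINT x|P. f x * iexp (s * X x)) = (CLINT x|Q. f x * iexp (s * X x))"
    and B [measurable]: "B \<in> sets borel"
  shows "(\<integral>x. f x * indicator B (X x) \<partial>P) = (\<integral>x. f x * indicator B (X x) \<partial>Q)"
proof -
  have int: "integrable R f"
    if "prob_space R" "f \<in> borel_measurable R" for R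
  proof -
    interpret prob_space R by fact
    show ?thesis
      using that f0 fC by (intro integrable_const_bound[of _ C]) auto
  qed
  have [measurable]: "X \<in> borel_measurable Q" "f \<in> borel_measurable Q"
    using X f PQ by (auto cong: measurable_cong_sets)
  define c where "c = integral\<^sup>L P f"
  \<comment> \<open>Frequency \<open>0\<close> in \<open>eq\<close> shows that both sides have the
    same mass, so one constant normalises both.\<close>
  have cQ: "c = integral\<^sup>L Q f"
    using eq[of 0] by (simp add: c_def)
  have c0: "0 \<le> c" using f0 by (simp add: c_def)
  define D where "D R = distr (density R (\<lambda>x. ennreal (f x / c))) borel X" for R
  have props: "real_distribution (D R)"
      "char (D R) s = (CLINT x|R. f x * iexp (s * X x)) / c"
      "measure (D R) B = (\<integral>x. f x * indicator B (X x) \<partial>R) / c"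
    if R: "prob_space R" and [measurable]: "X \<in> borel_measurable R" "f \<in> borel_measurable R"
      and cR: "c = integral\<^sup>L R f" and c: "c > 0" for R s
  proof -
    interpret R: prob_space R by fact
    have i: "integrable R f" by (rule int[OF R]) measurable
    have "emeasure (density R (\<lambda>x. ennreal (f x / c))) (space R) = (\<integral>\<^sup>+x. ennreal (f x / c) \<partial>R)"
      by (subst emeasure_density) (auto intro!: nn_integral_cong)
    also have "\<dots> = ennreal (\<integral>x. f x / c \<partial>R)"
      by (rule nn_integral_eq_integral) (use i f0 c in auto)
    also have "\<dots> = 1" using c by (simp add: cR[symmetric])
    finally have "emeasure (density R (\<lambda>x. ennreal (f x / c))) (space R) = 1" .
    then interpret d: prob_space "density R (\<lambda>x. ennreal (f x / c))"
      by (intro prob_spaceI) simp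
    show "real_distribution (D R)"
      unfolding D_def by (rule d.real_distribution_distr) simp
    have "char (D R) s = (CLINT x|R. (f x / c) *\<^sub>R iexp (s * X x))"
      unfolding D_def char_def using f0 c
      by (subst integral_distr, simp, simp, subst integral_density) auto
    also have "\<dots> = (CLINT x|R. f x * iexp (s * X x) / c)"
      by (simp add: scaleR_conv_of_real field_simps)
    finally show "char (D R) s = (CLINT x|R. f x * iexp (s * X x)) / c"
      by simp
    interpret DR: real_distribution "D R" by fact
    have "measure (D R) B = (\<integral>x. indicator B x \<partial>D R)"
      by simp
    also have "\<dots> = (\<integral>x. (f x / c) *\<^sub>R indicator B (X x) \<partial>R)"
      unfolding D_def using f0 c
      by (subst integral_distr, simp, simp, subst integral_density) auto
    also have "\<dots> = (\<integral>x. f x * indicator B (X x) / c \<partial>R)"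
      by simp
    finally show "measure (D R) B = (\<integral>x. f x * indicator B (X x) \<partial>R) / c"
      by simp
  qed
  show ?thesis
  proof (cases "c = 0")
    case True
    have z: "(\<integral>x. f x * indicator B (X x) \<partial>R) = 0"
      if R: "prob_space R" and [measurable]: "X \<in> borel_measurable R" "f \<in> borel_measurable R"
      and cR: "c = integral\<^sup>L R f" for R
    proof -
      have "AE x in R. f x = 0"
        using integral_nonneg_eq_0_iff_AE[OF int[OF R]] f0 cR True by simp
      then have "(\<integral>x. f x * indicator B (X x) \<partial>R) = (\<integral>x. 0 \<partial>R)"
        by (intro integral_cong_AE) auto
      then show ?thesis by simp
    qed
    show ?thesis using z[OF P] z[OF Q] cQ c_def by simp
  next
    case False
    then have c: "c > 0" using c0 by simp
    note pP = props[OF P _ _ c_def c] and pQ = props[OF Q _ _ cQ c]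
    have "D P = D Q"
      by (rule Levy_uniqueness) (use pP pQ eq in \<open>auto simp: fun_eq_iff\<close>)
    then show ?thesis using pP(3) pQ(3) c by simp
  qed
qed

text \<open>The coordinates are turned into indicators one at a time: with \<open>w\<close> the product of the
  indicators already obtained, \<open>w (1 + cos (t \<bullet> x + \<theta>))\<close> is a nonnegative weight, so the
  one-dimensional uniqueness theorem applies to the next coordinate under this weight, and the
  phases \<open>\<theta> = 0\<close> and \<open>\<theta> = - \<pi> / 2\<close> recover the complex exponential.\<close>

theorem measure_eqI_char:
  fixes P Q :: "'v::euclidean_space measure"
  assumes P: "prob_space P" and Q: "prob_space Q"
    and bP [measurable_cong]: "sets P = sets borel" and bQ [measurable_cong]: "sets Q = sets borel"
    and eq: "\<And>t. (CLINT x|P. iexp (t \<bullet> x)) = (CLINT x|Q. iexp (t \<bullet> x))"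
  shows "P = Q"
proof -
  interpret P: prob_space P by fact
  interpret Q: prob_space Q by fact
  have *: "(CLINT x|P. (\<Prod>j\<in>J. indicator (A j) (x \<bullet> j) :: real) * iexp (t \<bullet> x)) =
         (CLINT x|Q. (\<Prod>j\<in>J. indicator (A j) (x \<bullet> j) :: real) * iexp (t \<bullet> x))"
    if "finite J" and [measurable]: "\<And>j. A j \<in> sets (borel :: real measure)" for J A t
    using \<open>finite J\<close>
  \<comment> \<open>The frequency has to vary: the step for \<open>t\<close> uses the hypothesis at
    \<open>s *\<^sub>R j\<close>, \<open>s *\<^sub>R j + t\<close> and
    \<open>s *\<^sub>R j - t\<close>.\<close>
  proof (induction J arbitrary: t)
    case empty
    then show ?case using eq by simp
  next
    case (insert j J)
    define w where "w x = (\<Prod>j\<in>J. indicator (A j) (x \<bullet> j) :: real)" for x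
    have [measurable]: "w \<in> borel_measurable borel" unfolding w_def by measurable
    have w: "0 \<le> w x" "w x \<le> 1" for x
      by (auto simp: w_def intro!: prod_nonneg prod_le_1)
    have [simp]: "\<bar>w x\<bar> \<le> 1" for x using w[of x] by simp
    have IH: "(CLINT x|P. w x * iexp (t \<bullet> x)) = (CLINT x|Q. w x * iexp (t \<bullet> x))" for t
      unfolding w_def by (rule insert.IH)
    have i [simp]: "complex_integrable R (\<lambda>x. w x * iexp (t \<bullet> x))"
      if "prob_space R" and [measurable_cong]: "sets R = sets borel" for R t
    proof -
      interpret prob_space R by fact
      show ?thesis by (intro integrable_const_bound[of _ 1]) (auto simp: norm_mult)
    qed
    have cos_eq: "(\<integral>x. w x * (1 + cos (t \<bullet> x + \<theta>)) * indicator (A j) (x \<bullet> j) \<partial>P) =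
          (\<integral>x. w x * (1 + cos (t \<bullet> x + \<theta>)) * indicator (A j) (x \<bullet> j) \<partial>Q)" for \<theta>
    proof (rule integral_indicator_eqI_weighted_char[OF P Q, where C = 2])
      fix s :: real
      \<comment> \<open>Writing the cosine as half the sum of two exponentials turns the weighted
        integrand into a combination of three terms, each \<open>w\<close> times a pure exponential
        in \<open>x\<close>; the induction hypothesis covers all three.\<close>
      have e: "complex_of_real (w x * (1 + cos (t \<bullet> x + \<theta>))) * iexp (s * (x \<bullet> j)) =
          w x * iexp ((s *\<^sub>R j) \<bullet> x) +
          (iexp \<theta> / 2 * (w x * iexp ((s *\<^sub>R j + t) \<bullet> x)) +
           iexp (- \<theta>) / 2 * (w x * iexp ((s *\<^sub>R j - t) \<bullet> x)))" for x
      proof -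
        have add: "iexp (y + z) = iexp y * iexp z" for y z
          by (simp add: exp_add[symmetric] ring_distribs)
        have "complex_of_real (cos y) = (iexp y + iexp (- y)) / 2" for y
          by (simp add: cos_of_real[symmetric] cos_exp_eq)
        then have cos: "complex_of_real (cos (t \<bullet> x + \<theta>)) =
            (iexp (t \<bullet> x) * iexp \<theta> + iexp (- (t \<bullet> x)) * iexp (- \<theta>)) / 2"
          by (simp only: add minus_add_distrib)
        have inner: "(s *\<^sub>R j) \<bullet> x = s * (x \<bullet> j)"
          "(s *\<^sub>R j + t) \<bullet> x = s * (x \<bullet> j) + t \<bullet> x"
          "(s *\<^sub>R j - t) \<bullet> x = s * (x \<bullet> j) + - (t \<bullet> x)"
          by (simp_all add: inner_add_left inner_diff_left inner_commute[of x j])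
        have "complex_of_real (w x * (1 + cos (t \<bullet> x + \<theta>))) = w x * (1 + complex_of_real (cos (t \<bullet> x + \<theta>)))"
          by simp
        then show ?thesis
          unfolding inner add cos
          by (simp only: ring_distribs add_divide_distrib times_divide_eq_right times_divide_eq_left
              mult_ac mult_1_left mult_1_right)
      qed
      have "(CLINT x|R. complex_of_real (w x * (1 + cos (t \<bullet> x + \<theta>))) * iexp (s * (x \<bullet> j))) =
          (CLINT x|R. w x * iexp ((s *\<^sub>R j) \<bullet> x)) +
          (iexp \<theta> / 2 * (CLINT x|R. w x * iexp ((s *\<^sub>R j + t) \<bullet> x)) +
           iexp (- \<theta>) / 2 * (CLINT x|R. w x * iexp ((s *\<^sub>R j - t) \<bullet> x)))"
        if "prob_space R" "sets R = sets borel" for R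
        unfolding e using i[OF that]
        by (subst Bochner_Integration.integral_add integral_mult_right_zero
            | intro Bochner_Integration.integrable_add integrable_mult_right i that)+ simp
      from this[OF P bP] this[OF Q bQ]
      show "(CLINT x|P. complex_of_real (w x * (1 + cos (t \<bullet> x + \<theta>))) * iexp (s * (x \<bullet> j))) =
          (CLINT x|Q. complex_of_real (w x * (1 + cos (t \<bullet> x + \<theta>))) * iexp (s * (x \<bullet> j)))"
        by (simp only: IH)
    next
      fix x
      have "\<bar>cos (t \<bullet> x + \<theta>)\<bar> \<le> 1" by simp
      then have c: "0 \<le> 1 + cos (t \<bullet> x + \<theta>)" "1 + cos (t \<bullet> x + \<theta>) \<le> 2" by linarith+
      show "0 \<le> w x * (1 + cos (t \<bullet> x + \<theta>))" using c w by simp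
      show "w x * (1 + cos (t \<bullet> x + \<theta>)) \<le> 2"
        using mult_mono[OF w(2) c(2)] c w by simp
    qed (auto simp: bP bQ)
    \<comment> \<open>This accounts for the summand \<open>1\<close> in \<open>1 + cos\<close>.
      Subtracting it leaves the bare cosine, which changes sign and so cannot itself serve as a
      weight.\<close>
    have one_eq: "(\<integral>x. w x * indicator (A j) (x \<bullet> j) \<partial>P) = (\<integral>x. w x * indicator (A j) (x \<bullet> j) \<partial>Q)"
    proof (rule integral_indicator_eqI_weighted_char[OF P Q, where C = 1])
      show "(CLINT x|P. complex_of_real (w x) * iexp (s * (x \<bullet> j))) =
          (CLINT x|Q. complex_of_real (w x) * iexp (s * (x \<bullet> j)))" for s
        using IH[of "s *\<^sub>R j"] by (simp add: inner_commute)
    qed (auto simp: bP bQ w)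
    define v where "v x = w x * indicator (A j) (x \<bullet> j)" for x
    have [measurable]: "v \<in> borel_measurable borel" unfolding v_def by measurable
    have v: "\<bar>v x\<bar> \<le> 1" for x using w[of x] by (auto simp: v_def indicator_def)
    have bnd: "integrable R (\<lambda>x. v x * g x)"
      if "prob_space R" and [measurable_cong]: "sets R = sets borel"
        and [measurable]: "g \<in> borel_measurable borel" and "\<And>x. \<bar>g x\<bar> \<le> 1" for R and g :: "'v \<Rightarrow> real"
    proof -
      interpret prob_space R by fact
      show ?thesis
        using mult_mono[OF v that(4)]
        by (intro integrable_const_bound[of _ 1]) (auto simp: abs_mult)
    qed
    have "(\<integral>x. v x * cos (t \<bullet> x + \<theta>) \<partial>P) = (\<integral>x. v x * cos (t \<bullet> x + \<theta>) \<partial>Q)" for \<theta>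
    proof -
      have "(\<integral>x. v x * cos (t \<bullet> x + \<theta>) \<partial>R) =
          (\<integral>x. w x * (1 + cos (t \<bullet> x + \<theta>)) * indicator (A j) (x \<bullet> j) \<partial>R) - (\<integral>x. v x \<partial>R)"
        if R: "prob_space R" "sets R = sets borel" for R
      proof -
        have *: "w x * (1 + cos (t \<bullet> x + \<theta>)) * indicator (A j) (x \<bullet> j) = v x * 1 + v x * cos (t \<bullet> x + \<theta>)" for x
          by (simp add: v_def algebra_simps)
        have "integrable R (\<lambda>x. v x * 1)" "integrable R (\<lambda>x. v x * cos (t \<bullet> x + \<theta>))"
          by (rule bnd[OF R]; simp)+
        then show ?thesis unfolding * by simp
      qed
      from this[OF P bP] this[OF Q bQ] show ?thesis
        using cos_eq[of \<theta>] one_eq by (simp add: v_def)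
    qed
    from this[of 0] this[of "- (pi/2)"]
    have cs: "(\<integral>x. v x * cos (t \<bullet> x) \<partial>P) = (\<integral>x. v x * cos (t \<bullet> x) \<partial>Q)"
      "(\<integral>x. v x * sin (t \<bullet> x) \<partial>P) = (\<integral>x. v x * sin (t \<bullet> x) \<partial>Q)"
      by (simp_all add: cos_diff)
    have "(CLINT x|R. v x * iexp (t \<bullet> x)) =
        (\<integral>x. v x * cos (t \<bullet> x) \<partial>R) + \<i> * (\<integral>x. v x * sin (t \<bullet> x) \<partial>R)"
      if R: "prob_space R" "sets R = sets borel" for R
    proof -
      have *: "v x * iexp (t \<bullet> x) =
          complex_of_real (v x * cos (t \<bullet> x)) + \<i> * complex_of_real (v x * sin (t \<bullet> x))" for x
        by (simp add: exp_Euler cos_of_real sin_of_real algebra_simps)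
      have "complex_integrable R (\<lambda>x. complex_of_real (v x * cos (t \<bullet> x)))"
        "complex_integrable R (\<lambda>x. complex_of_real (v x * sin (t \<bullet> x)))"
        by (rule integrable_of_real, rule bnd[OF R]; simp)+
      then show ?thesis unfolding *
        by (subst Bochner_Integration.integral_add)
          (simp_all only: integrable_mult_right integral_mult_right_zero integral_complex_of_real)
    qed
    from this[OF P bP] this[OF Q bQ]
    have "(CLINT x|P. v x * iexp (t \<bullet> x)) = (CLINT x|Q. v x * iexp (t \<bullet> x))"
      by (simp only: cs)
    moreover have "(\<Prod>j\<in>insert j J. indicator (A j) (x \<bullet> j) :: real) = v x" for x
      using insert.hyps by (simp add: v_def w_def mult.commute)
    ultimately show ?case by simp
  qed
  \<comment> \<open>Frequency \<open>0\<close> and all basis directions at once: the product of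
    interval indicators is the indicator of the box. Boxes are stable under intersection, generate
    the Borel sets and exhaust the space, so agreement on them suffices.\<close>
  have box: "emeasure P (box a b) = emeasure Q (box a b)" for a b :: 'v
  proof -
    have ind: "indicator (box a b) x = (\<Prod>j\<in>Basis. indicator {a \<bullet> j<..<b \<bullet> j} (x \<bullet> j) :: real)" for x
      by (auto simp: indicator_def box_def prod_zero_iff)
    have "complex_of_real (\<integral>x. indicator (box a b) x \<partial>P) = complex_of_real (\<integral>x. indicator (box a b) x \<partial>Q)"
      using *[of Basis "\<lambda>j. {a \<bullet> j<..<b \<bullet> j}" 0] by (simp add: ind flip: of_real_prod)
    then have "measure P (box a b) = measure Q (box a b)"
      by (simp add: bP bQ sets_eq_imp_space_eq[OF bP] sets_eq_imp_space_eq[OF bQ])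
    then show ?thesis
      by (simp add: P.emeasure_eq_measure Q.emeasure_eq_measure)
  qed
  show ?thesis
  proof (rule measure_eqI_generator_eq)
    let ?E = "range (\<lambda>(a, b). box a b :: 'v set)"
    show "Int_stable ?E" by (auto simp: Int_stable_def box_Int_box)
    show "?E \<subseteq> Pow UNIV" by simp
    show "emeasure P X = emeasure Q X" if "X \<in> ?E" for X using that box by auto
    show "sets P = sigma_sets UNIV ?E" "sets Q = sigma_sets UNIV ?E"
      by (simp_all add: bP bQ borel_eq_box)
    show "range (\<lambda>n. box (- real n *\<^sub>R One) (real n *\<^sub>R One)) \<subseteq> ?E" by auto
    show "(\<Union>n. box (- real n *\<^sub>R One) (real n *\<^sub>R One)) = (UNIV :: 'v set)"
      using UN_box_eq_UNIV by simp
    show "emeasure P (box (- real n *\<^sub>R One) (real n *\<^sub>R One)) \<noteq> \<infinity>" for n by simp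
  qed
qed

section \<open>Normal laws and centred Gaussian vectors\<close>

lemma sets_normal_law [simp, measurable_cong]: "sets (normal_law m s) = sets borel"
  by (simp add: normal_law_def)

lemma
  assumes "0 \<le> s"
  shows integrable_normal_law_power: "integrable (normal_law m s) (\<lambda>x. (x - m) ^ k)"
    and integrable_normal_law: "integrable (normal_law m s) (\<lambda>x. x)"
    and integral_normal_law: "(\<integral>x. x \<partial>normal_law m s) = m"
    and variance_normal_law: "(\<integral>x. (x - m)\<^sup>2 \<partial>normal_law m s) = s\<^sup>2"
proof -
  \<comment> \<open>The degenerate case \<open>s = 0\<close> has no density; integration against the
    point mass is evaluation at \<open>m\<close>.\<close>
  have r: "integrable (return borel m) g" "(\<integral>x. g x \<partial>return borel m) = g m"
    if "g \<in> borel_measurable borel" for g :: "real \<Rightarrow> real"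
    using that by (auto simp: integral_return integrable_iff_bounded nn_integral_return)
  show "integrable (normal_law m s) (\<lambda>x. (x - m) ^ k)"
    using assms integrable_normal_moment[of s m k]
    by (cases "s = 0") (simp_all add: normal_law_def r integrable_density)
  show "integrable (normal_law m s) (\<lambda>x. x)"
    using assms integrable_normal_moment_nz_1[of s m]
    by (cases "s = 0") (simp_all add: normal_law_def r integrable_density)
  show "(\<integral>x. x \<partial>normal_law m s) = m"
    using assms integral_normal_moment_nz_1[of s m]
    by (cases "s = 0") (simp_all add: normal_law_def r integral_density)
  show "(\<integral>x. (x - m)\<^sup>2 \<partial>normal_law m s) = s\<^sup>2"
    using assms integral_normal_moment_even[of s m 1]
    by (cases "s = 0") (simp_all add: normal_law_def r integral_density)
qed

text \<open>For \<open>s > 0\<close> the law is that of \<open>s\<close> times a standard normal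
  variable, so the factor \<open>s\<close> moves into the frequency. For \<open>s = 0\<close> both
  sides are \<open>1\<close>.\<close>

lemma char_normal_law_centered:
  assumes "0 \<le> s"
  shows "char (normal_law 0 s) t = exp (- ((s * t)\<^sup>2 / 2))"
proof (cases "s = 0")
  case True
  then show ?thesis by (simp add: normal_law_def char_def integral_return)
next
  case False
  interpret prob_space std_normal_distribution
    by (rule prob_space_normal_density) simp
  have "distributed std_normal_distribution lborel (\<lambda>x. x) std_normal_density"
    by (simp add: distributed_def distr_id2)
  from normal_density_affine[OF this, of s 0] have
    "distributed std_normal_distribution lborel (\<lambda>x. s * x) (normal_density 0 s)"
    using assms False by simp
  then have "normal_law 0 s = distr std_normal_distribution lborel (\<lambda>x. s * x)"
    using False by (simp add: normal_law_def distributed_def)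
  then have "char (normal_law 0 s) t = char std_normal_distribution (s * t)"
    by (simp add: char_def integral_distr mult_ac)
  then show ?thesis by (simp add: char_std_normal_distribution)
qed

lemma gaussian_vector_measurable: "gaussian_vector M X \<Longrightarrow> X \<in> borel_measurable M"
  by (simp add: gaussian_vector_def)

text \<open>The location parameter left existential in \<open>gaussian_vector\<close> can only be
  the mean, because it is the first moment of \<open>normal_law\<close>.\<close>

lemma gaussian_vector_inner:
  assumes "gaussian_vector M X"
  obtains s where "0 \<le> s" "distr M borel (\<lambda>\<omega>. a \<bullet> X \<omega>) = normal_law (\<integral>\<omega>. a \<bullet> X \<omega> \<partial>M) s"
proof -
  note [measurable] = gaussian_vector_measurable[OF assms]
  obtain m s where s: "0 \<le> s" and d: "distr M borel (\<lambda>\<omega>. a \<bullet> X \<omega>) = normal_law m s"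
    using assms unfolding gaussian_vector_def by blast
  have "(\<integral>\<omega>. a \<bullet> X \<omega> \<partial>M) = (\<integral>x. x \<partial>distr M borel (\<lambda>\<omega>. a \<bullet> X \<omega>))"
    by (simp add: integral_distr)
  then have "m = (\<integral>\<omega>. a \<bullet> X \<omega> \<partial>M)" using s by (simp add: d integral_normal_law)
  with s d that show ?thesis by blast
qed

text \<open>Each projection to a basis vector has a normal law and is therefore integrable; the
  vector is the finite sum of these components.\<close>

lemma gaussian_vector_integrable:
  assumes "gaussian_vector M X"
  shows "integrable M X"
proof -
  note [measurable] = gaussian_vector_measurable[OF assms]
  have "integrable M (\<lambda>\<omega>. X \<omega> \<bullet> b)" for b
  proof -
    obtain s where "0 \<le> s" "distr M borel (\<lambda>\<omega>. b \<bullet> X \<omega>) = normal_law (\<integral>\<omega>. b \<bullet> X \<omega> \<partial>M) s"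
      using gaussian_vector_inner[OF assms] .
    then have "integrable (distr M borel (\<lambda>\<omega>. b \<bullet> X \<omega>)) (\<lambda>x. x)"
      by (simp add: integrable_normal_law)
    then show ?thesis by (simp add: integrable_distr_eq inner_commute)
  qed
  then have "integrable M (\<lambda>\<omega>. \<Sum>b\<in>Basis. (X \<omega> \<bullet> b) *\<^sub>R b)"
    by (intro Bochner_Integration.integrable_sum integrable_scaleR_left)
  then show ?thesis by (simp add: euclidean_representation)
qed

lemma gaussian_vector_square_integrable:
  assumes "gaussian_vector M X" and mean: "(\<integral>\<omega>. X \<omega> \<partial>M) = 0"
  shows "integrable M (\<lambda>\<omega>. (a \<bullet> X \<omega>)\<^sup>2)"
proof -
  note [measurable] = gaussian_vector_measurable[OF assms(1)]
  have m: "(\<integral>\<omega>. a \<bullet> X \<omega> \<partial>M) = 0"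
    using gaussian_vector_integrable[OF assms(1)] mean by simp
  obtain s where "0 \<le> s" "distr M borel (\<lambda>\<omega>. a \<bullet> X \<omega>) = normal_law (\<integral>\<omega>. a \<bullet> X \<omega> \<partial>M) s"
    using gaussian_vector_inner[OF assms(1)] .
  then have "integrable (distr M borel (\<lambda>\<omega>. a \<bullet> X \<omega>)) (\<lambda>x. x\<^sup>2)"
    using integrable_normal_law_power[of s 0 2] m by simp
  then show ?thesis by (simp add: integrable_distr_eq)
qed

text \<open>A projection is centred normal, so its law is fixed by its variance. Expanding the
  square into coordinate products identifies that variance with the quadratic form
  \<open>a \<bullet> (\<Sigma> *v a)\<close>.\<close>

lemma char_multivariate_normal_centered:
  fixes X :: "'a \<Rightarrow> real ^ 'k"
  assumes "multivariate_normal M X 0 \<Sigma>"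
  shows "char (distr M borel (\<lambda>\<omega>. a \<bullet> X \<omega>)) t = exp (- (t\<^sup>2 * (a \<bullet> (\<Sigma> *v a)) / 2))"
proof -
  have g: "gaussian_vector M X" and mean: "(\<integral>\<omega>. X \<omega> \<partial>M) = 0"
    and cov: "\<And>j k. cov M (\<lambda>\<omega>. X \<omega> $ j) (\<lambda>\<omega>. X \<omega> $ k) = \<Sigma> $ j $ k"
    using assms by (auto simp: multivariate_normal_def)
  note [measurable] = gaussian_vector_measurable[OF g]
  have m: "(\<integral>\<omega>. b \<bullet> X \<omega> \<partial>M) = 0" for b
    using gaussian_vector_integrable[OF g] mean by simp
  \<comment> \<open>Coordinates are written as projections so that the facts on projections apply to
    them.\<close>
  have c: "X \<omega> $ k = axis k 1 \<bullet> X \<omega>" for \<omega> k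
    by (simp add: inner_axis')
  have cv: "(\<integral>\<omega>. X \<omega> $ j * X \<omega> $ k \<partial>M) = \<Sigma> $ j $ k" for j k
    using cov[of j k] m[of "axis j 1"] m[of "axis k 1"] by (simp add: cov_def c[symmetric])
  \<comment> \<open>Needed to integrate the double sum term by term; the products are dominated by
    sums of squares.\<close>
  have ci: "integrable M (\<lambda>\<omega>. X \<omega> $ j * X \<omega> $ k)" for j k
  proof (rule Bochner_Integration.integrable_bound)
    show "integrable M (\<lambda>\<omega>. (X \<omega> $ j)\<^sup>2 + (X \<omega> $ k)\<^sup>2)"
      unfolding c by (intro Bochner_Integration.integrable_add gaussian_vector_square_integrable g mean)
    have "\<bar>x * y\<bar> \<le> x\<^sup>2 + y\<^sup>2" for x y :: real
    proof -
      have "2 * \<bar>x * y\<bar> \<le> x\<^sup>2 + y\<^sup>2"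
        using sum_squares_bound[of "\<bar>x\<bar>" "\<bar>y\<bar>"] by (simp add: abs_mult mult.assoc)
      then show ?thesis using abs_ge_zero[of "x * y"] by linarith
    qed
    then show "AE \<omega> in M. norm (X \<omega> $ j * X \<omega> $ k) \<le> norm ((X \<omega> $ j)\<^sup>2 + (X \<omega> $ k)\<^sup>2)"
      by simp
  qed (unfold c, measurable)
  have "(\<integral>\<omega>. (a \<bullet> X \<omega>)\<^sup>2 \<partial>M) = (\<integral>\<omega>. (\<Sum>j\<in>UNIV. \<Sum>k\<in>UNIV. a $ j * a $ k * (X \<omega> $ j * X \<omega> $ k)) \<partial>M)"
    by (simp add: inner_vec_def power2_eq_square sum_product mult_ac)
  also have "\<dots> = (\<Sum>j\<in>UNIV. \<Sum>k\<in>UNIV. a $ j * a $ k * \<Sigma> $ j $ k)"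
    by (simp add: ci cv)
  also have "\<dots> = a \<bullet> (\<Sigma> *v a)"
    by (simp add: inner_vec_def matrix_vector_mult_def sum_distrib_left mult_ac)
  finally have v: "(\<integral>\<omega>. (a \<bullet> X \<omega>)\<^sup>2 \<partial>M) = a \<bullet> (\<Sigma> *v a)" .
  obtain s where s: "0 \<le> s" and d: "distr M borel (\<lambda>\<omega>. a \<bullet> X \<omega>) = normal_law 0 s"
    using gaussian_vector_inner[OF g, of a] m by metis
  have "(\<integral>\<omega>. (a \<bullet> X \<omega>)\<^sup>2 \<partial>M) = (\<integral>x. x\<^sup>2 \<partial>distr M borel (\<lambda>\<omega>. a \<bullet> X \<omega>))"
    by (simp add: integral_distr)
  also have "\<dots> = s\<^sup>2"
    using variance_normal_law[OF s, of 0] by (simp add: d)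
  finally show ?thesis
    using v s by (simp add: d char_normal_law_centered power_mult_distrib mult.commute)
qed

section \<open>The maximal coordinate\<close>

lemma max_coord_ge: "u $ k \<le> max_coord u"
  by (simp add: max_coord_def)

lemma max_coord_le: "(\<And>k. u $ k \<le> c) \<Longrightarrow> max_coord u \<le> c"
  by (simp add: max_coord_def)

lemma max_coord_attained: obtains k where "max_coord u = u $ k"
proof -
  have "max_coord u \<in> range (\<lambda>k. u $ k)"
    unfolding max_coord_def by (rule Max_in) auto
  with that show ?thesis by blast
qed

text \<open>Compare both vectors at a coordinate where \<open>u\<close> attains its maximum. This
  Lipschitz bound yields measurability, and with \<open>v = 0\<close> the growth bound behind
  integrability.\<close>

lemma max_coord_diff_le: "max_coord u - max_coord v \<le> norm (u - v)"
proof -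
  obtain k where "max_coord u = u $ k" by (rule max_coord_attained)
  moreover have "u $ k - v $ k \<le> norm (u - v)"
    using component_le_norm_cart[of "u - v" k] by simp
  ultimately show ?thesis using max_coord_ge[of v k] by linarith
qed

lemma abs_max_coord_le_norm: "\<bar>max_coord u\<bar> \<le> norm u"
proof -
  have "max_coord (0 :: real ^ 'a) = 0" by (simp add: max_coord_def)
  then show ?thesis
    using max_coord_diff_le[of u 0] max_coord_diff_le[of 0 u] by simp
qed

lemma max_coord_measurable [measurable]: "max_coord \<in> borel_measurable borel"
proof (rule borel_measurable_continuous_onI)
  have "dist (max_coord u) (max_coord v) \<le> 1 * dist u v" for u v :: "real ^ 'a"
    using max_coord_diff_le[of u v] max_coord_diff_le[of v u]
    by (simp add: dist_norm norm_minus_commute)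
  then show "continuous_on UNIV (max_coord :: real ^ 'a \<Rightarrow> real)"
    by (intro lipschitz_on_continuous_on[of 1] lipschitz_onI) auto
qed

lemma max_coord_scaleR:
  assumes "0 \<le> c"
  shows "max_coord (c *\<^sub>R u) = c * max_coord u"
proof (rule antisym)
  show "max_coord (c *\<^sub>R u) \<le> c * max_coord u"
    using assms by (intro max_coord_le) (simp add: mult_left_mono max_coord_ge)
  obtain k where "max_coord u = u $ k" by (rule max_coord_attained)
  then show "c * max_coord u \<le> max_coord (c *\<^sub>R u)"
    using max_coord_ge[of "c *\<^sub>R u" k] by simp
qed

lemma integrable_max_coord: "integrable M X \<Longrightarrow> integrable M (\<lambda>\<omega>. max_coord (X \<omega>))"
  by (rule Bochner_Integration.integrable_bound[of M X])
    (auto simp: abs_max_coord_le_norm)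

section \<open>Increments of the square root\<close>

lemma sqrt_diff_asymp_equiv:
  "(\<lambda>i. sqrt (real i) - sqrt (real i - 1)) \<sim>[sequentially] (\<lambda>i. 1 / (2 * sqrt (real i)))"
  by real_asymp

text \<open>This is \<open>(x + y)\<^sup>2 \<le> 2 * (x\<^sup>2 + y\<^sup>2)\<close> for the two
  outer roots, whose squares add up to \<open>2 * n\<close>. The bound \<open>1 \<le> n\<close>
  keeps the radicand \<open>n - 1\<close> nonnegative.\<close>

lemma sqrt_concave_step:
  assumes "1 \<le> n"
  shows "sqrt (real n + 1) - sqrt (real n) \<le> sqrt (real n) - sqrt (real n - 1)"
proof -
  have "(sqrt (real n + 1) + sqrt (real n - 1))\<^sup>2 \<le> 2 * ((sqrt (real n + 1))\<^sup>2 + (sqrt (real n - 1))\<^sup>2)"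
    using sum_squares_bound[of "sqrt (real n + 1)" "sqrt (real n - 1)"] by (simp add: power2_sum)
  also have "\<dots> = (2 * sqrt (real n))\<^sup>2" using assms by (simp add: power_mult_distrib)
  finally have "sqrt (real n + 1) + sqrt (real n - 1) \<le> 2 * sqrt (real n)"
    by (rule power2_le_imp_le) simp
  then show ?thesis by simp
qed

section \<open>Law of the walk and expected premium\<close>

text \<open>Reduces the hypothesis of \<open>measure_eqI_char\<close> to characteristic functions of
  one-dimensional projections, at frequency \<open>1\<close>.\<close>

lemma integral_iexp_inner_distr:
  fixes X :: "'a \<Rightarrow> 'v::euclidean_space"
  assumes [measurable]: "X \<in> borel_measurable M"
  shows "(CLINT x|distr M borel X. iexp (a \<bullet> x)) = char (distr M borel (\<lambda>\<omega>. a \<bullet> X \<omega>)) 1"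
  by (simp add: char_def integral_distr)

lemma distr_walk:
  fixes Y :: "nat \<Rightarrow> 'a \<Rightarrow> real ^ 'k"
  assumes "prob_space M" "prob_space N"
    and indep: "prob_space.indep_vars M (\<lambda>_. borel) Y {1..}"
    and Y: "\<And>i. 1 \<le> i \<Longrightarrow> multivariate_normal M (Y i) 0 \<Sigma>"
    and Z: "multivariate_normal N Z 0 \<Sigma>"
  shows "distr M borel (walk Y n) = distr N borel (\<lambda>\<omega>. sqrt (real n) *\<^sub>R Z \<omega>)"
proof -
  interpret M: prob_space M by fact
  interpret N: prob_space N by fact
  have [measurable]: "Z \<in> borel_measurable N" "\<And>i. 1 \<le> i \<Longrightarrow> Y i \<in> borel_measurable M"
    using Z Y by (auto simp: multivariate_normal_def gaussian_vector_def)
  have [measurable]: "walk Y n \<in> borel_measurable M"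
    unfolding walk_def [abs_def] by measurable
  show ?thesis
  proof (rule measure_eqI_char)
    fix a
    have ind: "M.indep_vars (\<lambda>_. borel) (\<lambda>i \<omega>. a \<bullet> Y i \<omega>) {1..n}"
      by (rule M.indep_vars_compose2[OF M.indep_vars_subset[OF indep]]) auto
    have "(CLINT x|distr M borel (walk Y n). iexp (a \<bullet> x)) =
        char (distr M borel (\<lambda>\<omega>. \<Sum>i=1..n. a \<bullet> Y i \<omega>)) 1"
      by (subst integral_iexp_inner_distr) (simp_all add: walk_def inner_sum_right)
    also have "\<dots> = (\<Prod>i=1..n. char (distr M borel (\<lambda>\<omega>. a \<bullet> Y i \<omega>)) 1)"
      by (rule M.char_distr_sum[OF ind])
    also have "\<dots> = (\<Prod>i=1..n. complex_of_real (exp (- ((a \<bullet> (\<Sigma> *v a)) / 2))))"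
      by (rule prod.cong) (simp_all add: char_multivariate_normal_centered[OF Y])
    \<comment> \<open>The number \<open>n\<close> of equal factors is written as the square of
      \<open>sqrt n\<close>, so that the product reads as the characteristic function of
      \<open>a \<bullet> Z\<close> at frequency \<open>sqrt n\<close>; the frequency is then
      absorbed into the vector.\<close>
    also have "\<dots> = exp (- ((sqrt (real n))\<^sup>2 * (a \<bullet> (\<Sigma> *v a)) / 2))"
      by (simp add: exp_of_nat_mult[symmetric] flip: of_real_power)
    also have "\<dots> = char (distr N borel (\<lambda>\<omega>. a \<bullet> Z \<omega>)) (sqrt (real n))"
      by (rule char_multivariate_normal_centered[OF Z, symmetric])
    also have "\<dots> = char (distr N borel (\<lambda>\<omega>. a \<bullet> (sqrt (real n) *\<^sub>R Z \<omega>))) 1"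
      by (simp add: char_def integral_distr)
    also have "\<dots> = (CLINT x|distr N borel (\<lambda>\<omega>. sqrt (real n) *\<^sub>R Z \<omega>). iexp (a \<bullet> x))"
      by (rule integral_iexp_inner_distr[symmetric]) measurable
    finally show "(CLINT x|distr M borel (walk Y n). iexp (a \<bullet> x)) =
        (CLINT x|distr N borel (\<lambda>\<omega>. sqrt (real n) *\<^sub>R Z \<omega>). iexp (a \<bullet> x))" .
  qed (auto intro: M.prob_space_distr N.prob_space_distr)
qed

text \<open>The two variables are functions of the disjoint index blocks \<open>{1..n}\<close> and
  \<open>{Suc n}\<close> of an independent family.\<close>

lemma (in prob_space) indep_var_walk:
  fixes Y :: "nat \<Rightarrow> 'a \<Rightarrow> real ^ 'k"
  assumes "indep_vars (\<lambda>_. borel) Y {1..}"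
  shows "indep_var borel (walk Y n) borel (Y (Suc n))"
proof -
  have "indep_var borel ((\<lambda>f. \<Sum>i=1..n. f i) \<circ> (\<lambda>\<omega>. restrict (\<lambda>i. Y i \<omega>) {1..n}))
      borel ((\<lambda>f. f (Suc n)) \<circ> (\<lambda>\<omega>. restrict (\<lambda>i. Y i \<omega>) {Suc n}))"
    by (rule indep_var_compose[OF indep_var_restrict[OF assms]]) auto
  moreover have "(\<Sum>i=1..n. restrict (\<lambda>i. Y i \<omega>) {1..n} i) = walk Y n \<omega>" for \<omega>
    unfolding walk_def by (rule sum.cong) auto
  ultimately show ?thesis by (simp add: comp_def)
qed

text \<open>Independence makes the joint law a product, so the inner average over \<open>y\<close>
  followed by the average over \<open>S\<close> is one integral of \<open>max_coord (S + X)\<close>.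
  Fubini is justified by the integrability of \<open>S + X\<close>.\<close>

lemma (in prob_space)
  fixes S X :: "'a \<Rightarrow> real ^ 'k"
  assumes indep: "indep_var borel S borel X"
    and S: "integrable M S" and X: "integrable M X"
  shows integrable_selection_premium:
      "integrable M (\<lambda>\<omega>. selection_premium (distr M borel X) (S \<omega>))" (is ?int)
    and expectation_selection_premium:
      "expectation (\<lambda>\<omega>. selection_premium (distr M borel X) (S \<omega>)) =
        expectation (\<lambda>\<omega>. max_coord (S \<omega> + X \<omega>)) - expectation (\<lambda>\<omega>. max_coord (S \<omega>))" (is ?eq)
proof -
  have [measurable]: "S \<in> borel_measurable M" "X \<in> borel_measurable M"
    using S X by auto
  let ?S = "distr M borel S" and ?X = "distr M borel X"
  interpret S: prob_space ?S by (rule prob_space_distr) simp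
  interpret X: prob_space ?X by (rule prob_space_distr) simp
  interpret SX: pair_prob_space ?S ?X ..
  have joint: "?S \<Otimes>\<^sub>M ?X = distr M (borel \<Otimes>\<^sub>M borel) (\<lambda>\<omega>. (S \<omega>, X \<omega>))"
    using indep by (simp add: indep_var_distribution_eq)
  let ?f = "\<lambda>p :: (real ^ 'k) \<times> (real ^ 'k). max_coord (fst p + snd p)"
  have int_sum: "integrable M (\<lambda>\<omega>. max_coord (S \<omega> + X \<omega>))"
    by (intro integrable_max_coord Bochner_Integration.integrable_add S X)
  have int: "integrable (?S \<Otimes>\<^sub>M ?X) ?f"
    unfolding joint using int_sum by (subst integrable_distr_eq) simp_all
  have "integrable ?S (\<lambda>s. \<integral>y. max_coord (s + y) \<partial>?X)"
    using SX.integrable_fst'[OF int] by simp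
  then have inner: "integrable M (\<lambda>\<omega>. \<integral>y. max_coord (S \<omega> + y) \<partial>?X)"
    by (rule integrable_distr[rotated]) simp
  show ?int
    unfolding selection_premium_def
    by (intro Bochner_Integration.integrable_diff inner integrable_max_coord S)
  have "(\<integral>\<omega>. (\<integral>y. max_coord (S \<omega> + y) \<partial>?X) \<partial>M) = (\<integral>s. (\<integral>y. max_coord (s + y) \<partial>?X) \<partial>?S)"
    by (subst integral_distr) simp_all
  also have "\<dots> = integral\<^sup>L (?S \<Otimes>\<^sub>M ?X) ?f"
    using SX.integral_fst'[OF int] by simp
  also have "\<dots> = (\<integral>\<omega>. max_coord (S \<omega> + X \<omega>) \<partial>M)"
    unfolding joint by (subst integral_distr) simp_all
  finally show ?eq
    unfolding selection_premium_def
    by (subst Bochner_Integration.integral_diff) (auto intro!: inner integrable_max_coord S)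
qed

text \<open>The maximum dominates any single coordinate, whose mean is \<open>0\<close>; a
  coordinate exists since the index type is nonempty.\<close>

lemma expectation_max_coord_nonneg:
  fixes Z :: "'b \<Rightarrow> real ^ 'k"
  assumes Z: "integrable N Z" and mean: "(\<integral>\<omega>. Z \<omega> \<partial>N) = 0"
  shows "0 \<le> (\<integral>\<omega>. max_coord (Z \<omega>) \<partial>N)"
proof -
  fix k :: 'k
  have "0 = (\<integral>\<omega>. axis k 1 \<bullet> Z \<omega> \<partial>N)" using Z mean by simp
  also have "\<dots> \<le> (\<integral>\<omega>. max_coord (Z \<omega>) \<partial>N)"
    by (intro integral_mono integrable_max_coord integrable_inner_right Z)
      (simp_all add: inner_axis' max_coord_ge)
  finally show ?thesis .
qed

theorem theorem5p2:
  fixes M :: "'a measure" and N :: "'b measure"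
    and Y :: "nat \<Rightarrow> 'a \<Rightarrow> real ^ 'k" and Z :: "'b \<Rightarrow> real ^ 'k"
    and \<Sigma> :: "real ^ 'k ^ 'k"
    and \<phi> :: "real ^ 'k \<Rightarrow> real" and \<psi> :: "nat \<Rightarrow> real"
  assumes "prob_space M" and "prob_space N"
    and indep: "prob_space.indep_vars M (\<lambda>_. borel) Y {1..}"
    and ident: "\<And>i. i \<ge> 1 \<Longrightarrow> distr M borel (Y i) = distr M borel (Y 1)"
    and gauss: "\<And>i. i \<ge> 1 \<Longrightarrow> gaussian_vector M (Y i)"
    and mean: "\<And>i. i \<ge> 1 \<Longrightarrow> (\<integral>\<omega>. Y i \<omega> \<partial>M) = 0"
    and covar: "\<And>i j k. i \<ge> 1 \<Longrightarrow> cov M (\<lambda>\<omega>. Y i \<omega> $ j) (\<lambda>\<omega>. Y i \<omega> $ k) = \<Sigma> $ j $ k"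
    and Z: "multivariate_normal N Z 0 \<Sigma>"
    and \<phi>: "\<phi> = selection_premium (distr M borel (Y 1))"
    and \<psi>: "\<And>i. \<psi> i = (\<integral>\<omega>. \<phi> (walk Y (i - 1) \<omega>) \<partial>M) / \<phi> 0"
  shows
    \<comment> \<open>all expectations involved exist\<close>
    "(integrable N (\<lambda>\<omega>. max_coord (Z \<omega>)) \<and>
      (\<forall>n. integrable M (walk_max Y n)) \<and>
      (\<forall>u. integrable (distr M borel (Y 1)) (\<lambda>y. max_coord (u + y))) \<and>
      (\<forall>n. integrable M (\<lambda>\<omega>. \<phi> (walk Y n \<omega>)))) \<and>
     \<comment> \<open>(a)\<close>
     (\<forall>n. (\<integral>\<omega>. walk_max Y n \<omega> \<partial>M) = sqrt (real n) * (\<integral>\<omega>. max_coord (Z \<omega>) \<partial>N)) \<and>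
     \<comment> \<open>(b)\<close>
     (\<forall>i\<ge>1. (\<integral>\<omega>. \<phi> (walk Y (i - 1) \<omega>) \<partial>M) =
        (\<integral>\<omega>. max_coord (Z \<omega>) \<partial>N) * (sqrt (real i) - sqrt (real i - 1))) \<and>
     \<comment> \<open>(c), where the quotient only makes sense if its denominator is nonzero\<close>
     (\<phi> 0 \<noteq> 0 \<longrightarrow>
        (\<forall>i\<ge>1. \<psi> i = sqrt (real i) - sqrt (real i - 1)) \<and>
        \<psi> \<sim>[sequentially] (\<lambda>i. 1 / (2 * sqrt (real i)))) \<and>
     (\<lambda>i. sqrt (real i) - sqrt (real i - 1)) \<sim>[sequentially] (\<lambda>i. 1 / (2 * sqrt (real i))) \<and>
     \<comment> \<open>(d)\<close>
     concave_seq (\<lambda>n. \<integral>\<omega>. walk_max Y n \<omega> \<partial>M) \<and>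
     (\<forall>n\<ge>1. (\<integral>\<omega>. \<phi> (walk Y n \<omega>) \<partial>M) \<le> (\<integral>\<omega>. \<phi> (walk Y (n - 1) \<omega>) \<partial>M))"
proof -
  interpret M: prob_space M by fact
  interpret N: prob_space N by fact
  define L where "L = (\<integral>\<omega>. max_coord (Z \<omega>) \<partial>N)"
  define E where "E n = (\<integral>\<omega>. walk_max Y n \<omega> \<partial>M)" for n
  have Yn: "multivariate_normal M (Y i) 0 \<Sigma>" if "1 \<le> i" for i
    using gauss mean covar that by (simp add: multivariate_normal_def)
  have iY: "integrable M (Y i)" if "1 \<le> i" for i
    using gauss[OF that] by (rule gaussian_vector_integrable)
  have gZ: "gaussian_vector N Z" "(\<integral>\<omega>. Z \<omega> \<partial>N) = 0"
    using Z by (auto simp: multivariate_normal_def)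
  note iZ = gaussian_vector_integrable[OF gZ(1)]
  have [measurable]: "Z \<in> borel_measurable N" "Y 1 \<in> borel_measurable M"
    using iZ iY[of 1] by auto
  have iW: "integrable M (walk Y n)" for n
    unfolding walk_def [abs_def] by (rule Bochner_Integration.integrable_sum) (simp add: iY)
  then have [measurable]: "walk Y n \<in> borel_measurable M" for n by auto
  have iWm: "integrable M (walk_max Y n)" for n
    unfolding walk_max_def [abs_def] by (rule integrable_max_coord[OF iW])
  have a: "E n = sqrt (real n) * L" for n
  proof -
    have "E n = (\<integral>x. max_coord x \<partial>distr M borel (walk Y n))"
      by (simp add: E_def walk_max_def integral_distr)
    also have "\<dots> = (\<integral>\<omega>. max_coord (sqrt (real n) *\<^sub>R Z \<omega>) \<partial>N)"
      by (simp add: distr_walk[OF assms(1,2) indep Yn Z] integral_distr)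
    finally show ?thesis by (simp add: max_coord_scaleR L_def)
  qed
  \<comment> \<open>The premium is rewritten with the law of the next increment, the one that is
    independent of \<open>walk Y n\<close>.\<close>
  have \<phi>_law: "\<phi> = selection_premium (distr M borel (Y (Suc n)))" for n
    using \<phi> ident[of "Suc n"] by simp
  have i\<phi>: "integrable M (\<lambda>\<omega>. \<phi> (walk Y n \<omega>))" for n
    unfolding \<phi>_law[of n]
    by (rule M.integrable_selection_premium[OF M.indep_var_walk[OF indep] iW iY]) simp
  have E\<phi>: "(\<integral>\<omega>. \<phi> (walk Y n \<omega>) \<partial>M) = E (Suc n) - E n" for n
    unfolding \<phi>_law[of n] E_def walk_max_def
    by (subst M.expectation_selection_premium[OF M.indep_var_walk[OF indep] iW iY])
      (simp_all add: walk_def)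
  have b: "(\<integral>\<omega>. \<phi> (walk Y (i - 1) \<omega>) \<partial>M) = L * (sqrt (real i) - sqrt (real i - 1))"
    if "1 \<le> i" for i
    using E\<phi>[of "i - 1"] that by (simp add: a of_nat_diff algebra_simps)
  \<comment> \<open>The case \<open>i = 1\<close> of \<open>b\<close>: the walk starts at
    \<open>0\<close> and the square root increment is \<open>1\<close>.\<close>
  have \<phi>0: "\<phi> 0 = L"
    using b[of 1] by (simp add: walk_def M.prob_space)
  have c: "\<psi> i = sqrt (real i) - sqrt (real i - 1)" if "\<phi> 0 \<noteq> 0" "1 \<le> i" for i
    using that b[of i] by (simp add: \<psi> \<phi>0)
  have c_asymp: "\<psi> \<sim>[sequentially] (\<lambda>i. 1 / (2 * sqrt (real i)))" if "\<phi> 0 \<noteq> 0"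
  proof -
    \<comment> \<open>The formula \<open>c\<close> is available from index \<open>1\<close> on,
      which suffices for the asymptotics.\<close>
    have "eventually (\<lambda>i. sqrt (real i) - sqrt (real i - 1) = \<psi> i) sequentially"
      using eventually_ge_at_top[of 1] by eventually_elim (simp add: c that)
    then show ?thesis
      by (rule asymp_equiv_transfer[OF sqrt_diff_asymp_equiv]) simp
  qed
  \<comment> \<open>The sign matters for (d): concavity of the square root is multiplied by
    \<open>L\<close>.\<close>
  have "0 \<le> L" unfolding L_def using iZ gZ(2) by (rule expectation_max_coord_nonneg)
  then have d: "E (n + 1) - E n \<le> E n - E (n - 1)" if "1 \<le> n" for n
    using mult_left_mono[OF sqrt_concave_step[OF that], of L] that
    by (simp add: a of_nat_diff algebra_simps)
  have d': "(\<integral>\<omega>. \<phi> (walk Y n \<omega>) \<partial>M) \<le> (\<integral>\<omega>. \<phi> (walk Y (n - 1) \<omega>) \<partial>M)" if "1 \<le> n" for n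
    using d[OF that] that by (simp add: E\<phi>)
  have i_shift: "integrable (distr M borel (Y 1)) (\<lambda>y. max_coord (u + y))" for u
    using iY[of 1] by (subst integrable_distr_eq) (auto intro!: integrable_max_coord)
  show ?thesis
    using integrable_max_coord[OF iZ] iWm i_shift i\<phi> a b c c_asymp d d' sqrt_diff_asymp_equiv
    unfolding E_def L_def concave_seq_def by blast
qed

end
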